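(* Let system $\mathcal{S}_a$ have contracting dynamics, i.e. there are a compact set $\mathcal A\subset\mathbb R^n$, a function $\beta\in\mathcal{KL}$ and a constant $c>0$ with $$\|\mathbf x(t)\|_{\mathcal A}\le\beta(\|\mathbf x(t_0)\|_{\mathcal A},t-t_0)+c\,\|u_a\|_{\infty,[t_0,t]}\quad\text{for all } t_0\in\mathbb R_+,\ t\ge t_0,$$ and let system $\mathcal{S}_w$ have wandering dynamics, i.e. $\mathcal S_w$ is forward-complete ($u_w\in\mathcal U_w$ implies $\mathbf z\in\mathcal Z$ for all $t\ge t_0$, $t_0\in\mathbb R_+$) and there are an output function $h:\mathbb R^m\to\mathbb R$ and functions $\gamma_0,\gamma_1\in\mathcal K_{\infty,e}$ with $$\int_{t_0}^t\gamma_1(u_w(\tau))\,d\tau\le h(\mathbf z(t_0))-h(\mathbf z(t))\le\int_{t_0}^t\gamma_0(u_w(\tau))\,d\tau\quad\text{for all } t_0\in\mathbb R_+,\ t\ge t_0,$$ where, moreover, for any $M\in\mathbb R_+$ there are functions $\gamma_{0,1},\gamma_{0,2}:\mathbb R_+\to\mathbb R_+$ with $\gamma_0(ab)\le\gamma_{0,1}(a)\gamma_{0,2}(b)$ for all $a,b\in[0,M]$. Consider their interconnection with $u_a(t)=h(\mathbf z(t))$, $u_w(t)=\|\mathbf x(t)\|_{\mathcal A}$, i.e. $$\|\mathbf x(t)\|_{\mathcal A}\le \beta(\|\mathbf x(t_0)\|_{\mathcal A},t-t_0)+c\,\|h(\mathbf z(\cdot))\|_{\infty,[t_0,t]},$$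 $$\int_{t_0}^{t}\gamma_1(\|\mathbf x(\tau)\|_{\mathcal A})\,d\tau\le h(\mathbf z(t_0))-h(\mathbf z(t))\le\int_{t_0}^{t}\gamma_0(\|\mathbf x(\tau)\|_{\mathcal A})\,d\tau .$$ Suppose there exist sequences $\mathcal S=\{\sigma_i\}_{i=0}^\infty$, $\Xi=\{\xi_i\}_{i=0}^\infty$, $\mathcal T=\{\tau_i\}_{i=0}^\infty$ satisfying Conditions (P1), (P2), (P3) of the context, with $B_1,B_2$ the bounding functions in (P3). Suppose in addition: 1) there exists a number $\Delta_0>0$ such that $$\frac{1}{\tau_i}\,\frac{\sigma_i-\sigma_{i+1}}{\gamma_{0,1}(\sigma_i)}\ge\Delta_0\quad\text{for all } i=0,1,2,\dots;$$ 2) the set $\Omega_\gamma$ of all points $(\mathbf x_0,\mathbf z_0)$ satisfying $$\gamma_{0,2}\big(B_1(\|\mathbf x_0\|_{\mathcal A})+B_2(|h(\mathbf z_0)|,c)+c\,|h(\mathbf z_0)|\big)\le h(\mathbf z_0)\,\Delta_0$$ is not empty; 3) $\sum_{i=0}^\infty\tau_i=\infty$. Then for all $(\mathbf x_0,\mathbf z_0)\in\Omega_\gamma$ the state $(\mathbf x(t,\mathbf x_0),\mathbf z(t,\mathbf z_0))$ of the interconnection, with $\mathbf x(t_0)=\mathbf x_0$, $\mathbf z(t_0)=\mathbf z_0$, converges as $t\to\infty$ into the set $$\Omega_a=\{(\mathbf x,\mathbf z)\ :\ \|\mathbf x\|_{\mathcal A}\le c\cdot h(\mathbf z_0),\ \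 h(\mathbf z)\in[0,h(\mathbf z_0)]\}.$$
   Context: Notation. $\mathbb R_+=[0,\infty)$. $\mathcal K$ is the class of strictly increasing functions $\kappa:\mathbb R_+\to\mathbb R_+$ with $\kappa(0)=0$; $\mathcal K_\infty$ those with in addition $\kappa(s)\to\infty$ as $s\to\infty$; $\mathcal K_e$ (resp. $\mathcal K_{\infty,e}$) is the class of functions whose restriction to $[0,\infty)$ is in $\mathcal K$ (resp. $\mathcal K_\infty$). $\mathcal{KL}$ is the class of $\beta:\mathbb R_+\times\mathbb R_+\to\mathbb R_+$ with $\beta(\cdot,0)\in\mathcal K$ and, for each $s$, $\beta(s,\cdot)$ monotonically decreasing to $0$. $\|\mathbf x\|_{\mathcal A}=\inf_{\mathbf q\in\mathcal A}\|\mathbf x-\mathbf q\|$ (Euclidean norm); $\|f\|_{\infty,[t_0,t]}=\sup_{\tau\in[t_0,t]}\|f(\tau)\|$. Systems. $\mathcal S_a:(u_a,\mathbf x_0)\mapsto\mathbf x(t)\in\mathbb R^n$ and $\mathcal S_w:(u_w,\mathbf z_0)\mapsto\mathbf z(t)\in\mathbb R^m$, with scalar inputs $u_a\in\mathcal U_a\subseteq L_\infty[t_0,\infty]$, $u_w\in\mathcal U_w\subseteq L_\infty[t_0,\infty]$, initial conditions $\mathbf x_0\in\mathbb R^n$, $\mathbf z_0\in\mathbb R^m$, and state trajectories in $\mathcal X\subseteq L^n_\infty[t_0,\infty]$, $\mathcal Z\subseteq L^m_\infty[t_0,\infty]$. Contracting dynamics: there are a compact set $\mathcal A\subset\mathbb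 R^n$, $\beta\in\mathcal{KL}$ and $c>0$ with $\|\mathbf x(t)\|_{\mathcal A}\le\beta(\|\mathbf x(t_0)\|_{\mathcal A},t-t_0)+c\|u_a\|_{\infty,[t_0,t]}$ for all $t_0\in\mathbb R_+$, $t\ge t_0$ (any time may serve as starting time $t_0$). Wandering dynamics: $\mathcal S_w$ is forward-complete ($u_w\in\mathcal U_w$ implies $\mathbf z\in\mathcal Z$ for all $t\ge t_0$, $t_0\in\mathbb R_+$) and there are an output function $h:\mathbb R^m\to\mathbb R$ and $\gamma_0,\gamma_1\in\mathcal K_{\infty,e}$ with $\int_{t_0}^t\gamma_1(u_w(\tau))d\tau\le h(\mathbf z(t_0))-h(\mathbf z(t))\le\int_{t_0}^t\gamma_0(u_w(\tau))d\tau$ for all $t_0\in\mathbb R_+$, $t\ge t_0$. Moreover, for any $M\in\mathbb R_+$ there are functions $\gamma_{0,1},\gamma_{0,2}:\mathbb R_+\to\mathbb R_+$ with $\gamma_0(ab)\le\gamma_{0,1}(a)\gamma_{0,2}(b)$ for all $a,b\in[0,M]$. The functions $\gamma_{0,1},\gamma_{0,2}$ in the claim are such functions, for an $M$ large enough that the arguments at which they are evaluated in the claim lie in $[0,M]$. Conditions on the sequences ($\sigma_i$ real, $\xi_i\in\mathbb R_+$, $\tau_i>0$): (P1) $\{\sigma_n\}$ is strictly monotone, $\sigma_0=1$, $\lim_{n\to\infty}\sigma_n=0$. (P2) For every $i$: $\beta(s,T)\le\xi_i\,\beta(s,0)$ for all $s\in\mathbb R_+$ and all $T\ge\tau_i$.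 (P3) For each $i\ge0$ define functions $\phi_j=\phi_j^{(i)}$, $\upsilon_j=\upsilon_j^{(i)}$, $j=0,\dots,i$, by $\phi_0(s)=\beta(s,0)$, $\phi_j(s)=\phi_{j-1}\big(\rho_{\phi,j}(\xi_{i-j}\cdot\beta(s,0))\big)$ for $j=1,\dots,i$, and $\upsilon_0(s)=\beta(s,0)$, $\upsilon_j(s)=\phi_{j-1}(\rho_{\upsilon,j}(s))$ for $j=1,\dots,i$, where $\rho_{\phi,j},\rho_{\upsilon,j}\in\mathcal K$ satisfy $\phi_{j-1}(a+b)\le\phi_{j-1}(\rho_{\phi,j}(a))+\phi_{j-1}(\rho_{\upsilon,j}(b))$ for all $a,b\ge0$. Condition (P3) requires that there exist functions $B_1(\cdot)$, $B_2(\cdot,\cdot)$ such that for all $n=0,1,2,\dots$ $\sigma_n^{-1}\phi^{(n)}_n(\|\mathbf x_0\|_{\mathcal A})\le B_1(\|\mathbf x_0\|_{\mathcal A})$ and $\sigma_n^{-1}\sum_{i=0}^n\upsilon^{(n)}_i\big(c|h(\mathbf z_0)|\sigma_{n-i}\big)\le B_2(|h(\mathbf z_0)|,c)$. "Converges into $\Omega_a$" means that the distance of the state to $\Omega_a$ tends to $0$ as $t\to\infty$. *)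

theory Defs
  imports "HOL-Analysis.Analysis"
begin

text \<open>
  Functions on \<open>[0,\<infinity>)\<close> are represented by total functions on \<open>real\<close>; their values at negative
  arguments are never constrained. Hence \<open>class_K\<close> and \<open>class_K_inf\<close> also serve as the
  extended classes of functions on the whole real line whose restriction to \<open>[0,\<infinity>)\<close> lies in
  the respective class. The distance \<open>\<parallel>x\<parallel>\<^sub>A\<close> to a nonempty set \<open>A\<close> is \<open>infdist x A\<close>.
  No continuity is required of the comparison functions.
\<close>

definition class_K :: "(real \<Rightarrow> real) \<Rightarrow> bool" where
  "class_K \<kappa> \<longleftrightarrow> (\<forall>s\<ge>0. 0 \<le> \<kappa> s) \<and> strict_mono_on {0..} \<kappa> \<and> \<kappa> 0 = 0"

definition class_K_inf :: "(real \<Rightarrow> real) \<Rightarrow> bool" where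
  "class_K_inf \<kappa> \<longleftrightarrow> class_K \<kappa> \<and> filterlim \<kappa> at_top at_top"

definition class_KL :: "(real \<Rightarrow> real \<Rightarrow> real) \<Rightarrow> bool" where
  "class_KL \<beta> \<longleftrightarrow>
     (\<forall>s\<ge>0. \<forall>t\<ge>0. 0 \<le> \<beta> s t) \<and>
     class_K (\<lambda>s. \<beta> s 0) \<and>
     (\<forall>s\<ge>0. antimono_on {0..} (\<beta> s) \<and> (\<beta> s \<longlongrightarrow> 0) at_top)"

definition sup_norm :: "(real \<Rightarrow> 'v::real_normed_vector) \<Rightarrow> real \<Rightarrow> real \<Rightarrow> real" where
  "sup_norm f s t = (SUP \<tau>\<in>{s..t}. norm (f \<tau>))"

text \<open>Boundedness is taken with respect to the supremum, in accordance with \<open>sup_norm\<close>; functions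
  are not identified almost everywhere.\<close>

definition L_inf :: "real \<Rightarrow> (real \<Rightarrow> 'v::euclidean_space) set" where
  "L_inf t0 = {f. set_borel_measurable lebesgue {t0..} f \<and> bounded (f ` {t0..})}"

text \<open>\<open>S t0 u x0\<close> is the state trajectory with initial time \<open>t0\<close>, scalar input \<open>u\<close> and initial state
  \<open>x0\<close>; only its values on \<open>[t0,\<infinity>)\<close> are meaningful. The spaces \<open>U t0\<close> and \<open>X t0\<close> of admissible
  inputs and of state trajectories are indexed by the initial time as well.\<close>

type_synonym 's flow = "real \<Rightarrow> (real \<Rightarrow> real) \<Rightarrow> 's \<Rightarrow> real \<Rightarrow> 's"

definition input_state_system ::
  "(real \<Rightarrow> (real \<Rightarrow> real) set) \<Rightarrow> (real \<Rightarrow> (real \<Rightarrow> 's::euclidean_space) set) \<Rightarrow> 's flow \<Rightarrow> bool" where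
  "input_state_system U X S \<longleftrightarrow>
     (\<forall>t0\<ge>0. U t0 \<subseteq> L_inf t0 \<and> X t0 \<subseteq> L_inf t0 \<and> (\<forall>u\<in>U t0. \<forall>x0. S t0 u x0 t0 = x0))"

definition forward_complete ::
  "(real \<Rightarrow> (real \<Rightarrow> real) set) \<Rightarrow> (real \<Rightarrow> (real \<Rightarrow> 's::euclidean_space) set) \<Rightarrow> 's flow \<Rightarrow> bool" where
  "forward_complete U X S \<longleftrightarrow> (\<forall>t0\<ge>0. \<forall>u\<in>U t0. \<forall>x0. S t0 u x0 \<in> X t0)"

text \<open>In the next two definitions \<open>s\<close> is an arbitrary later time that serves as starting time.\<close>

definition contracting ::
  "(real \<Rightarrow> (real \<Rightarrow> real) set) \<Rightarrow> (real^'n) flow \<Rightarrow> (real^'n) set \<Rightarrow> (real \<Rightarrow> real \<Rightarrow> real) \<Rightarrow> real \<Rightarrow> bool"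
where
  "contracting U S A \<beta> c \<longleftrightarrow>
     compact A \<and> A \<noteq> {} \<and> class_KL \<beta> \<and> 0 < c \<and>
     (\<forall>t0\<ge>0. \<forall>u\<in>U t0. \<forall>x0. \<forall>s\<ge>t0. \<forall>t\<ge>s.
        infdist (S t0 u x0 t) A \<le> \<beta> (infdist (S t0 u x0 s) A) (t - s) + c * sup_norm u s t)"

definition product_bound :: "(real \<Rightarrow> real) \<Rightarrow> real \<Rightarrow> (real \<Rightarrow> real) \<Rightarrow> (real \<Rightarrow> real) \<Rightarrow> bool" where
  "product_bound \<gamma> M \<gamma>1 \<gamma>2 \<longleftrightarrow>
     (\<forall>a\<ge>0. 0 \<le> \<gamma>1 a \<and> 0 \<le> \<gamma>2 a) \<and>
     (\<forall>a\<in>{0..M}. \<forall>b\<in>{0..M}. \<gamma> (a * b) \<le> \<gamma>1 a * \<gamma>2 b)"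

text \<open>Existence of the integrals is spelled out because an input may take negative values, where
  \<open>\<gamma>0\<close> and \<open>\<gamma>1\<close> are arbitrary; for nonnegative inputs in \<open>L_inf\<close> it is automatic.\<close>

definition wandering ::
  "(real \<Rightarrow> (real \<Rightarrow> real) set) \<Rightarrow> (real \<Rightarrow> (real \<Rightarrow> real^'m) set) \<Rightarrow> (real^'m) flow \<Rightarrow>
   (real^'m \<Rightarrow> real) \<Rightarrow> (real \<Rightarrow> real) \<Rightarrow> (real \<Rightarrow> real) \<Rightarrow> bool"
where
  "wandering U Z S h \<gamma>0 \<gamma>1 \<longleftrightarrow>
     forward_complete U Z S \<and> class_K_inf \<gamma>0 \<and> class_K_inf \<gamma>1 \<and>
     (\<forall>t0\<ge>0. \<forall>u\<in>U t0. \<forall>z0. \<forall>s\<ge>t0. \<forall>t\<ge>s.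
        set_integrable lebesgue {s..t} (\<lambda>\<tau>. \<gamma>0 (u \<tau>)) \<and>
        set_integrable lebesgue {s..t} (\<lambda>\<tau>. \<gamma>1 (u \<tau>)) \<and>
        (LINT \<tau>:{s..t}|lebesgue. \<gamma>1 (u \<tau>)) \<le> h (S t0 u z0 s) - h (S t0 u z0 t) \<and>
        h (S t0 u z0 s) - h (S t0 u z0 t) \<le> (LINT \<tau>:{s..t}|lebesgue. \<gamma>0 (u \<tau>))) \<and>
     (\<forall>M\<ge>0. \<exists>\<gamma>01 \<gamma>02. product_bound \<gamma>0 M \<gamma>01 \<gamma>02)"

text \<open>\<open>(x, z)\<close> is a solution on \<open>[t0,\<infinity>)\<close> of the feedback interconnection
  \<open>ua t = h (z t)\<close>, \<open>uw t = \<parallel>x t\<parallel>\<^sub>A\<close> starting at \<open>(x0, z0)\<close>.\<close>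

definition interconnection_solution ::
  "(real \<Rightarrow> (real \<Rightarrow> real) set) \<Rightarrow> (real^'n) flow \<Rightarrow> (real \<Rightarrow> (real \<Rightarrow> real) set) \<Rightarrow> (real^'m) flow \<Rightarrow>
   (real^'n) set \<Rightarrow> (real^'m \<Rightarrow> real) \<Rightarrow> real \<Rightarrow> real^'n \<Rightarrow> real^'m \<Rightarrow>
   (real \<Rightarrow> real^'n) \<Rightarrow> (real \<Rightarrow> real^'m) \<Rightarrow> bool"
where
  "interconnection_solution Ua Sa Uw Sw A h t0 x0 z0 x z \<longleftrightarrow>
     (\<exists>ua\<in>Ua t0. \<exists>uw\<in>Uw t0. \<forall>t\<ge>t0.
        x t = Sa t0 ua x0 t \<and> z t = Sw t0 uw z0 t \<and>
        ua t = h (z t) \<and> uw t = infdist (x t) A)"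

definition condition_P1 :: "(nat \<Rightarrow> real) \<Rightarrow> bool" where
  "condition_P1 \<sigma> \<longleftrightarrow>
     (strict_mono \<sigma> \<or> monotone (<) (>) \<sigma>) \<and> \<sigma> 0 = 1 \<and> \<sigma> \<longlonglongrightarrow> 0"

definition condition_P2 ::
  "(real \<Rightarrow> real \<Rightarrow> real) \<Rightarrow> (nat \<Rightarrow> real) \<Rightarrow> (nat \<Rightarrow> real) \<Rightarrow> bool" where
  "condition_P2 \<beta> \<xi> \<tau> \<longleftrightarrow> (\<forall>i. \<forall>s\<ge>0. \<forall>T\<ge>\<tau> i. \<beta> s T \<le> \<xi> i * \<beta> s 0)"

text \<open>\<open>phi \<beta> \<xi> \<rho>\<phi> i j\<close> and \<open>upsilon \<beta> \<xi> \<rho>\<phi> \<rho>\<upsilon> i j\<close>, meant for \<open>j \<le> i\<close>, are the functions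
  \<open>\<phi>\<^sub>j\<close> and \<open>\<upsilon>\<^sub>j\<close> belonging to the index \<open>i\<close>. The auxiliary \<open>\<rho>\<phi> i j\<close> and \<open>\<rho>\<upsilon> i j\<close> may depend
  on \<open>i\<close>, since the inequality that they have to satisfy does.\<close>

primrec phi ::
  "(real \<Rightarrow> real \<Rightarrow> real) \<Rightarrow> (nat \<Rightarrow> real) \<Rightarrow> (nat \<Rightarrow> nat \<Rightarrow> real \<Rightarrow> real) \<Rightarrow> nat \<Rightarrow> nat \<Rightarrow> real \<Rightarrow> real" where
  "phi \<beta> \<xi> \<rho>\<phi> i 0 = (\<lambda>s. \<beta> s 0)"
| "phi \<beta> \<xi> \<rho>\<phi> i (Suc j) = (\<lambda>s. phi \<beta> \<xi> \<rho>\<phi> i j (\<rho>\<phi> i (Suc j) (\<xi> (i - Suc j) * \<beta> s 0)))"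

definition upsilon ::
  "(real \<Rightarrow> real \<Rightarrow> real) \<Rightarrow> (nat \<Rightarrow> real) \<Rightarrow> (nat \<Rightarrow> nat \<Rightarrow> real \<Rightarrow> real) \<Rightarrow>
   (nat \<Rightarrow> nat \<Rightarrow> real \<Rightarrow> real) \<Rightarrow> nat \<Rightarrow> nat \<Rightarrow> real \<Rightarrow> real" where
  "upsilon \<beta> \<xi> \<rho>\<phi> \<rho>\<upsilon> i j s = (if j = 0 then \<beta> s 0 else phi \<beta> \<xi> \<rho>\<phi> i (j - 1) (\<rho>\<upsilon> i j s))"

definition condition_P3 ::
  "(real \<Rightarrow> real \<Rightarrow> real) \<Rightarrow> real \<Rightarrow> (real^'n) set \<Rightarrow> (real^'m \<Rightarrow> real) \<Rightarrow> (nat \<Rightarrow> real) \<Rightarrow> (nat \<Rightarrow> real) \<Rightarrow>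
   (nat \<Rightarrow> nat \<Rightarrow> real \<Rightarrow> real) \<Rightarrow> (nat \<Rightarrow> nat \<Rightarrow> real \<Rightarrow> real) \<Rightarrow>
   (real \<Rightarrow> real) \<Rightarrow> (real \<Rightarrow> real \<Rightarrow> real) \<Rightarrow> bool"
where
  "condition_P3 \<beta> c A h \<sigma> \<xi> \<rho>\<phi> \<rho>\<upsilon> B1 B2 \<longleftrightarrow>
     (\<forall>i. \<forall>j\<in>{1..i}. class_K (\<rho>\<phi> i j) \<and> class_K (\<rho>\<upsilon> i j) \<and>
        (\<forall>a\<ge>0. \<forall>b\<ge>0. phi \<beta> \<xi> \<rho>\<phi> i (j - 1) (a + b) \<le>
           phi \<beta> \<xi> \<rho>\<phi> i (j - 1) (\<rho>\<phi> i j a) + phi \<beta> \<xi> \<rho>\<phi> i (j - 1) (\<rho>\<upsilon> i j b))) \<and>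
     (\<forall>n x0. inverse (\<sigma> n) * phi \<beta> \<xi> \<rho>\<phi> n n (infdist x0 A) \<le> B1 (infdist x0 A)) \<and>
     (\<forall>n z0. inverse (\<sigma> n) * (\<Sum>i=0..n. upsilon \<beta> \<xi> \<rho>\<phi> \<rho>\<upsilon> n i (c * \<bar>h z0\<bar> * \<sigma> (n - i)))
        \<le> B2 \<bar>h z0\<bar> c)"

definition gain_argument ::
  "(real^'n) set \<Rightarrow> (real^'m \<Rightarrow> real) \<Rightarrow> real \<Rightarrow> (real \<Rightarrow> real) \<Rightarrow> (real \<Rightarrow> real \<Rightarrow> real) \<Rightarrow>
   real^'n \<Rightarrow> real^'m \<Rightarrow> real" where
  "gain_argument A h c B1 B2 x0 z0 = B1 (infdist x0 A) + B2 \<bar>h z0\<bar> c + c * \<bar>h z0\<bar>"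

definition Omega_gamma ::
  "(real^'n) set \<Rightarrow> (real^'m \<Rightarrow> real) \<Rightarrow> real \<Rightarrow> (real \<Rightarrow> real) \<Rightarrow> (real \<Rightarrow> real \<Rightarrow> real) \<Rightarrow>
   (real \<Rightarrow> real) \<Rightarrow> real \<Rightarrow> ((real^'n) \<times> (real^'m)) set" where
  "Omega_gamma A h c B1 B2 \<gamma>02 \<Delta>0 =
     {(x0, z0). \<gamma>02 (gain_argument A h c B1 B2 x0 z0) \<le> h z0 * \<Delta>0}"

definition Omega_a ::
  "(real^'n) set \<Rightarrow> (real^'m \<Rightarrow> real) \<Rightarrow> real \<Rightarrow> real^'m \<Rightarrow> ((real^'n) \<times> (real^'m)) set" where
  "Omega_a A h c z0 = {(x, z). infdist x A \<le> c * h z0 \<and> h z \<in> {0..h z0}}"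

definition converges_into :: "(real \<Rightarrow> 'v::metric_space) \<Rightarrow> 'v set \<Rightarrow> bool" where
  "converges_into y \<Omega> \<longleftrightarrow> \<Omega> \<noteq> {} \<and> ((\<lambda>t. infdist (y t) \<Omega>) \<longlongrightarrow> 0) at_top"

end

theory Submission
  imports Defs
begin

text \<open>
  Along a solution put \<open>r t = infdist (x t) A\<close> and \<open>H t = h (z t)\<close>. The wandering estimate makes \<open>H\<close>
  nonincreasing, and Lipschitz because \<open>r\<close> is bounded. Everything reduces to showing that \<open>H\<close> never
  becomes negative: then \<open>0 \<le> H t \<le> h z0\<close>, the contraction estimate from the initial time gives
  \<open>r t \<le> \<beta> (r t0) (t - t0) + c * h z0\<close>, and the distance of the state to the target set is at most
  the vanishing first summand, since only the \<open>x\<close>-component has to be moved towards \<open>A\<close>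
  (\<open>converges_into_Omega_a\<close>).

  The definition of \<open>Omega_gamma\<close> forces \<open>h z0 \<ge> 0\<close>. Suppose first \<open>h z0 > 0\<close>
  (\<open>H_pos_forever\<close>). Let \<open>H\<close> reach the level \<open>\<sigma> i * h z0\<close> at time \<open>s i\<close>. If each of the
  earlier passages has taken at least \<open>\<tau> k\<close>, then (P2) lets \<open>r\<close> contract by \<open>\<xi> k\<close> during each of
  them up to a disturbance proportional to \<open>\<sigma> k\<close>; unrolling this recursion (\<open>recursion_bound\<close>)
  and using (P3) shows that between \<open>s i\<close> and \<open>s (i + 1)\<close> the value of \<open>r\<close> is at most \<open>\<sigma> i * G\<close>,
  where \<open>G\<close> is the gain argument. There \<open>H\<close> decreases at a rate at most
  \<open>\<gamma>0 (\<sigma> i * G) \<le> \<gamma>01 (\<sigma> i) * h z0 * \<Delta>0\<close>, so that by the rate condition the next passage takes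
  at least \<open>\<tau> i\<close>. The sum of the \<open>\<tau> i\<close> being infinite, \<open>H\<close> needs infinite time to reach \<open>0\<close>.

  If \<open>h z0 = 0\<close>, membership in \<open>Omega_gamma\<close> forces \<open>G = 0\<close>, hence \<open>x0 \<in> A\<close>: the loop starts from
  rest. That it does not leave the level \<open>0\<close> downwards is a uniqueness question for the
  differential inequality \<open>y' \<le> \<gamma>0 (c * y)\<close> satisfied by \<open>y = - H\<close>, and the rate condition together with the
  divergence of the sum of the \<open>\<tau> i\<close> supplies the Osgood condition that answers it
  (\<open>H_nonneg_from_rest\<close>).
\<close>

section \<open>Comparison functions\<close>

lemma class_K_mono: "class_K \<kappa> \<Longrightarrow> 0 \<le> a \<Longrightarrow> a \<le> b \<Longrightarrow> \<kappa> a \<le> \<kappa> b"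
  unfolding class_K_def using strict_mono_on_leD[of "{0..}" \<kappa> a b] by simp

lemma class_K_nonneg: "class_K \<kappa> \<Longrightarrow> 0 \<le> a \<Longrightarrow> 0 \<le> \<kappa> a"
  unfolding class_K_def by simp

lemma class_K_pos: "class_K \<kappa> \<Longrightarrow> 0 < a \<Longrightarrow> 0 < \<kappa> a"
  unfolding class_K_def using strict_mono_onD[of "{0..}" \<kappa> 0 a] by simp

lemma class_KL_at_0: "class_KL \<beta> \<Longrightarrow> class_K (\<lambda>s. \<beta> s 0)"
  unfolding class_KL_def by blast

lemma class_KL_le_at_0: "class_KL \<beta> \<Longrightarrow> 0 \<le> s \<Longrightarrow> 0 \<le> t \<Longrightarrow> \<beta> s t \<le> \<beta> s 0"
  unfolding class_KL_def monotone_on_def by simp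

lemma class_KL_zero:
  assumes "class_KL \<beta>" "0 \<le> t"
  shows "\<beta> 0 t \<le> 0"
  using class_KL_le_at_0[OF assms(1) order_refl assms(2)] class_KL_at_0[OF assms(1)]
  by (simp add: class_K_def)

lemma phi_mono_nonneg:
  assumes "class_KL \<beta>" and "\<And>i. 0 \<le> \<xi> i" and "\<And>j. j \<in> {1..n} \<Longrightarrow> class_K (\<rho>\<phi> n j)" and "j \<le> n"
  shows "\<forall>a b. 0 \<le> a \<longrightarrow> a \<le> b \<longrightarrow> 0 \<le> phi \<beta> \<xi> \<rho>\<phi> n j a \<and> phi \<beta> \<xi> \<rho>\<phi> n j a \<le> phi \<beta> \<xi> \<rho>\<phi> n j b"
  using assms(4)
proof (induction j)
  case 0
  note K = class_KL_at_0[OF assms(1)]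
  show ?case using class_K_mono[OF K] class_K_nonneg[OF K] by simp
next
  case (Suc j)
  note K = class_KL_at_0[OF assms(1)]
  have R: "class_K (\<rho>\<phi> n (Suc j))" using assms(3) Suc.prems by simp
  show ?case
  proof (intro allI impI)
    fix a b :: real assume ab: "0 \<le> a" "a \<le> b"
    let ?g = "\<lambda>s. \<xi> (n - Suc j) * \<beta> s 0"
    have 1: "0 \<le> ?g a" using class_K_nonneg[OF K ab(1)] assms(2) by simp
    have 2: "?g a \<le> ?g b" using class_K_mono[OF K ab] assms(2) by (simp add: mult_left_mono)
    have 3: "0 \<le> \<rho>\<phi> n (Suc j) (?g a)" by (rule class_K_nonneg[OF R 1])
    have 4: "\<rho>\<phi> n (Suc j) (?g a) \<le> \<rho>\<phi> n (Suc j) (?g b)" by (rule class_K_mono[OF R 1 2])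
    show "0 \<le> phi \<beta> \<xi> \<rho>\<phi> n (Suc j) a \<and> phi \<beta> \<xi> \<rho>\<phi> n (Suc j) a \<le> phi \<beta> \<xi> \<rho>\<phi> n (Suc j) b"
      using Suc.IH Suc.prems 3 4 by simp
  qed
qed

text \<open>The functions \<open>phi\<close> and \<open>upsilon\<close> unroll the recursion
  \<open>r (k + 1) \<le> \<xi> k * \<beta> (r k) 0 + d k\<close> backwards from \<open>k = n\<close>: each step splits the sum by the
  subadditivity property of \<open>\<rho>\<phi>\<close> and \<open>\<rho>\<upsilon>\<close>, passes the first summand on to the previous state, and
  leaves behind one \<open>upsilon\<close> of the disturbance.\<close>

lemma recursion_bound:
  assumes KL: "class_KL \<beta>" and \<xi>: "\<And>i. 0 \<le> \<xi> i"
    and P3: "condition_P3 \<beta> c A h \<sigma> \<xi> \<rho>\<phi> \<rho>\<upsilon> B1 B2"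
    and r: "\<And>k. 0 \<le> r k" and d: "\<And>k. 0 \<le> d k"
    and step: "\<And>k. k < n \<Longrightarrow> r (Suc k) \<le> \<xi> k * \<beta> (r k) 0 + d k"
    and "j \<le> n"
  shows "\<beta> (r n) 0 \<le> phi \<beta> \<xi> \<rho>\<phi> n j (r (n - j)) + (\<Sum>i=1..j. upsilon \<beta> \<xi> \<rho>\<phi> \<rho>\<upsilon> n i (d (n - i)))"
  using \<open>j \<le> n\<close>
proof (induction j)
  case 0
  then show ?case by simp
next
  case (Suc j)
  define k where "k = n - Suc j"
  have k: "n - j = Suc k" "k < n" using Suc.prems by (auto simp: k_def)
  have jn: "Suc j \<in> {1..n}" using Suc.prems by simp
  have \<rho>: "\<And>j. j \<in> {1..n} \<Longrightarrow> class_K (\<rho>\<phi> n j)" using P3 by (simp add: condition_P3_def)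
  have "\<forall>a\<ge>0. \<forall>b\<ge>0. phi \<beta> \<xi> \<rho>\<phi> n (Suc j - 1) (a + b) \<le>
      phi \<beta> \<xi> \<rho>\<phi> n (Suc j - 1) (\<rho>\<phi> n (Suc j) a) + phi \<beta> \<xi> \<rho>\<phi> n (Suc j - 1) (\<rho>\<upsilon> n (Suc j) b)"
    using P3 jn unfolding condition_P3_def by blast
  then have split: "phi \<beta> \<xi> \<rho>\<phi> n j (a + b)
      \<le> phi \<beta> \<xi> \<rho>\<phi> n j (\<rho>\<phi> n (Suc j) a) + phi \<beta> \<xi> \<rho>\<phi> n j (\<rho>\<upsilon> n (Suc j) b)"
    if "0 \<le> a" "0 \<le> b" for a b
    using that by simp
  have g: "0 \<le> \<xi> k * \<beta> (r k) 0"
    using class_K_nonneg[OF class_KL_at_0[OF KL] r] \<xi> by simp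
  have "phi \<beta> \<xi> \<rho>\<phi> n j (r (n - j)) \<le> phi \<beta> \<xi> \<rho>\<phi> n j (\<xi> k * \<beta> (r k) 0 + d k)"
    using phi_mono_nonneg[of \<beta> \<xi> n \<rho>\<phi> j] KL \<xi> \<rho> Suc.prems step[OF k(2)] r k(1) by simp
  also have "\<dots> \<le> phi \<beta> \<xi> \<rho>\<phi> n (Suc j) (r k) + upsilon \<beta> \<xi> \<rho>\<phi> \<rho>\<upsilon> n (Suc j) (d k)"
    using split[OF g d] by (simp add: upsilon_def k_def)
  finally show ?case
    using Suc.IH Suc.prems by (simp add: k_def)
qed

text \<open>Condition (P1) leaves only the decreasing case, since a sequence increasing from \<open>1\<close> cannot
  tend to \<open>0\<close>.\<close>

lemma condition_P1_decreasing:
  assumes "condition_P1 \<sigma>"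
  shows "\<sigma> (Suc i) < \<sigma> i" and "0 < \<sigma> i"
proof -
  have "\<not> strict_mono \<sigma>"
  proof
    assume "strict_mono \<sigma>"
    then have "mono \<sigma>" by (rule strict_mono_mono)
    then have "1 \<le> \<sigma> n" for n using assms monoD[OF \<open>mono \<sigma>\<close>, of 0 n] by (simp add: condition_P1_def)
    moreover have "\<sigma> \<longlonglongrightarrow> 0" using assms by (simp add: condition_P1_def)
    ultimately have "(1::real) \<le> 0" by (intro LIMSEQ_le_const) auto
    then show False by simp
  qed
  then have m: "\<sigma> m < \<sigma> n" if "n < m" for m n
    using assms that by (auto simp: condition_P1_def monotone_def)
  show "\<sigma> (Suc i) < \<sigma> i" by (simp add: m)
  have "\<sigma> n \<le> \<sigma> (Suc i)" if "Suc i \<le> n" for n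
    using m that by (cases "n = Suc i") (auto simp: less_imp_le)
  then have "0 \<le> \<sigma> (Suc i)"
    using assms unfolding condition_P1_def by (intro LIMSEQ_le_const2) auto
  then show "0 < \<sigma> i" using m[of i "Suc i"] by simp
qed

lemma unbounded_of_gaps:
  fixes s \<tau> :: "nat \<Rightarrow> real"
  assumes div: "filterlim (\<lambda>n. \<Sum>i<n. \<tau> i) at_top sequentially"
    and "0 < k" and gap: "\<And>i. k * \<tau> i \<le> s (Suc i) - s i"
  shows "\<exists>n. T < s n"
proof -
  have sum: "k * (\<Sum>i<n. \<tau> i) \<le> s n - s 0" for n
  proof (induction n)
    case (Suc n)
    then show ?case using gap[of n] by (simp add: distrib_left)
  qed simp
  obtain n where "(T - s 0) / k < (\<Sum>i<n. \<tau> i)"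
    using div unfolding filterlim_at_top_dense eventually_sequentially by blast
  then have "T - s 0 < k * (\<Sum>i<n. \<tau> i)" using \<open>0 < k\<close> by (simp add: field_simps)
  then show ?thesis using sum[of n] by (intro exI[of _ n]) linarith
qed

section \<open>The scalar feedback loop\<close>

text \<open>What the interconnection says about the two scalar signals \<open>r t = infdist (x t) A\<close> and
  \<open>H t = h (z t)\<close>: the supremum norm and the integral have been replaced by arbitrary bounds of the
  integrand on the interval.\<close>

locale feedback_loop =
  fixes t0 c :: real and r H \<gamma> :: "real \<Rightarrow> real" and \<beta> :: "real \<Rightarrow> real \<Rightarrow> real"
  assumes KL: "class_KL \<beta>" and c: "0 < c" and K: "class_K \<gamma>"
    and r_nonneg: "\<And>t. 0 \<le> r t"
    and r_bounded: "\<exists>R. \<forall>t\<ge>t0. r t \<le> R"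
    and contraction: "\<And>s t k. t0 \<le> s \<Longrightarrow> s \<le> t \<Longrightarrow> (\<And>u. u \<in> {s..t} \<Longrightarrow> \<bar>H u\<bar> \<le> k) \<Longrightarrow>
      r t \<le> \<beta> (r s) (t - s) + c * k"
    and antitone: "\<And>s t. t0 \<le> s \<Longrightarrow> s \<le> t \<Longrightarrow> H t \<le> H s"
    and decay: "\<And>s t k. t0 \<le> s \<Longrightarrow> s \<le> t \<Longrightarrow> (\<And>u. u \<in> {s..t} \<Longrightarrow> r u \<le> k) \<Longrightarrow>
      H s - H t \<le> \<gamma> k * (t - s)"
begin

lemma continuous_H: "continuous_on {t0..} H"
proof -
  obtain R where R: "\<forall>t\<ge>t0. r t \<le> R" using r_bounded by blast
  then have "0 \<le> R" using r_nonneg[of t0] by fastforce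
  then have \<gamma>R: "0 \<le> \<gamma> R" by (rule class_K_nonneg[OF K])
  have "\<bar>H s - H t\<bar> \<le> \<gamma> R * \<bar>s - t\<bar>" if "t0 \<le> s" "t0 \<le> t" for s t
    using that
  proof (induction s t rule: linorder_wlog)
    case (le a b)
    then show ?case using decay[of a b R] antitone[of a b] R by auto
  next
    case (sym a b)
    then show ?case by (simp add: abs_minus_commute)
  qed
  then have "(\<gamma> R)-lipschitz_on {t0..} H"
    using \<gamma>R by (auto intro!: lipschitz_onI simp: dist_real_def)
  then show ?thesis by (rule lipschitz_on_continuous_on)
qed

lemma attains:
  assumes "t0 \<le> T" "H T \<le> y" "y \<le> H t0"
  shows "\<exists>s\<ge>t0. s \<le> T \<and> H s = y"
  using IVT2'[of H T y t0] assms continuous_on_subset[OF continuous_H, of "{t0..T}"] by auto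

text \<open>If \<open>H\<close> became nonpositive, it would pass through all levels \<open>\<sigma> i * H t0\<close>, at times \<open>s i\<close>.
  As long as the earlier passages have taken at least \<open>\<tau> k\<close>, the contraction factors \<open>\<xi> k\<close> are
  available, and the bounds of condition (P3) confine \<open>r\<close> to \<open>\<sigma> i * G\<close> after \<open>s i\<close>. So small an \<open>r\<close>
  makes \<open>H\<close> so slow that the next passage takes \<open>\<tau> i\<close> again. These times add up to infinity.\<close>

lemma H_pos_forever:
  fixes A :: "(real^'n) set" and h :: "real^'m \<Rightarrow> real"
  assumes \<xi>: "\<And>i. 0 \<le> \<xi> i"
    and P1: "condition_P1 \<sigma>" and P2: "condition_P2 \<beta> \<xi> \<tau>"
    and P3: "condition_P3 \<beta> c A h \<sigma> \<xi> \<rho>\<phi> \<rho>\<upsilon> B1 B2"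
    and x0: "r t0 = infdist x0 A" and z0: "H t0 = h z0"
    and G: "G = gain_argument A h c B1 B2 x0 z0"
    and speed: "\<And>i. \<gamma> (\<sigma> i * G) * \<tau> i \<le> (\<sigma> i - \<sigma> (Suc i)) * H t0"
    and div: "filterlim (\<lambda>n. \<Sum>i<n. \<tau> i) at_top sequentially"
    and pos: "0 < H t0" and T: "t0 \<le> T"
  shows "0 < H T"
proof (rule ccontr)
  assume neg: "\<not> 0 < H T"
  note \<sigma>_dec = condition_P1_decreasing[OF P1]
  have \<sigma>0: "\<sigma> 0 = 1" using P1 by (simp add: condition_P1_def)
  have \<sigma>_le1: "\<sigma> i \<le> 1" for i
    using lift_Suc_antimono_le[of \<sigma> 0 i] \<sigma>0 \<sigma>_dec(1) by (simp add: less_imp_le)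
  \<comment> \<open>\<open>H\<close> may stay at its initial value for a while; the recursion for \<open>r\<close> has to begin at \<open>t0\<close>.\<close>
  have "\<exists>s. t0 \<le> s \<and> s \<le> T \<and> H s = \<sigma> i * H t0 \<and> (i = 0 \<longrightarrow> s = t0)" for i
  proof (cases "i = 0")
    case True
    then show ?thesis using T \<sigma>0 by auto
  next
    case False
    have "H T \<le> \<sigma> i * H t0" using neg \<sigma>_dec(2)[of i] pos by (smt (verit) mult_pos_pos)
    moreover have "\<sigma> i * H t0 \<le> H t0" using \<sigma>_le1[of i] pos by simp
    ultimately show ?thesis using attains[OF T] False by blast
  qed
  then obtain s where s: "\<And>i. t0 \<le> s i" "\<And>i. s i \<le> T" "\<And>i. H (s i) = \<sigma> i * H t0" "s 0 = t0"
    by metis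
  have s_le: "s i \<le> s (Suc i)" for i
  proof (rule ccontr)
    assume "\<not> s i \<le> s (Suc i)"
    then have "\<sigma> i * H t0 \<le> \<sigma> (Suc i) * H t0" using antitone[of "s (Suc i)" "s i"] s by simp
    then show False using \<sigma>_dec(1)[of i] pos by simp
  qed
  have H_le: "\<bar>H u\<bar> \<le> \<sigma> i * H t0" if "u \<in> {s i..s (Suc i)}" for i u
  proof -
    have "H u \<le> \<sigma> i * H t0" using antitone[of "s i" u] s that by auto
    moreover have "0 \<le> \<sigma> (Suc i) * H t0" using \<sigma>_dec(2)[of "Suc i"] pos by simp
    moreover have "\<sigma> (Suc i) * H t0 \<le> H u" using antitone[of u "s (Suc i)"] s(1)[of i] s(3) that by auto
    ultimately show ?thesis by simp
  qed
  have gap: "\<tau> n \<le> s (Suc n) - s n" for n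
  proof (induction n rule: less_induct)
    case (less n)
    define d where "d = (\<lambda>k. c * \<bar>h z0\<bar> * \<sigma> k)"
    have d_eq: "c * (\<sigma> k * H t0) = d k" for k using pos z0 by (simp add: d_def)
    have step: "r (s (Suc k)) \<le> \<xi> k * \<beta> (r (s k)) 0 + d k" if "k < n" for k
    proof -
      have "r (s (Suc k)) \<le> \<beta> (r (s k)) (s (Suc k) - s k) + d k"
        using contraction[OF s(1) s_le H_le] d_eq by simp
      moreover have "\<beta> (r (s k)) (s (Suc k) - s k) \<le> \<xi> k * \<beta> (r (s k)) 0"
        using P2 less[OF that] r_nonneg by (simp add: condition_P2_def)
      ultimately show ?thesis by simp
    qed
    have d0: "0 \<le> d k" for k using c \<sigma>_dec(2)[of k] by (simp add: d_def)
    have "\<beta> (r (s n)) 0 \<le> phi \<beta> \<xi> \<rho>\<phi> n n (r t0) + (\<Sum>i=1..n. upsilon \<beta> \<xi> \<rho>\<phi> \<rho>\<upsilon> n i (d (n - i)))"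
      using recursion_bound[OF KL \<xi> P3, of "\<lambda>k. r (s k)" d n n] r_nonneg d0 step s(4) by simp
    also have "(\<Sum>i=1..n. upsilon \<beta> \<xi> \<rho>\<phi> \<rho>\<upsilon> n i (d (n - i)))
        \<le> (\<Sum>i=0..n. upsilon \<beta> \<xi> \<rho>\<phi> \<rho>\<upsilon> n i (d (n - i)))"
      using class_K_nonneg[OF class_KL_at_0[OF KL] d0]
      by (simp add: sum.atLeast_Suc_atMost upsilon_def)
    also have "phi \<beta> \<xi> \<rho>\<phi> n n (r t0) \<le> \<sigma> n * B1 (infdist x0 A)"
    proof -
      have "inverse (\<sigma> n) * phi \<beta> \<xi> \<rho>\<phi> n n (infdist x0 A) \<le> B1 (infdist x0 A)"
        using P3 unfolding condition_P3_def by blast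
      then show ?thesis using \<sigma>_dec(2)[of n] x0 by (simp add: field_simps)
    qed
    also have "(\<Sum>i=0..n. upsilon \<beta> \<xi> \<rho>\<phi> \<rho>\<upsilon> n i (d (n - i))) \<le> \<sigma> n * B2 \<bar>h z0\<bar> c"
    proof -
      have "inverse (\<sigma> n) * (\<Sum>i=0..n. upsilon \<beta> \<xi> \<rho>\<phi> \<rho>\<upsilon> n i (d (n - i))) \<le> B2 \<bar>h z0\<bar> c"
        using P3 unfolding condition_P3_def d_def by blast
      then show ?thesis using \<sigma>_dec(2)[of n] by (simp add: field_simps)
    qed
    finally have \<beta>n: "\<beta> (r (s n)) 0 \<le> \<sigma> n * B1 (infdist x0 A) + \<sigma> n * B2 \<bar>h z0\<bar> c" by simp
    have rG: "r u \<le> \<sigma> n * G" if u: "u \<in> {s n..s (Suc n)}" for u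
    proof -
      have "r u \<le> \<beta> (r (s n)) (u - s n) + d n"
        using contraction[of "s n" u "\<sigma> n * H t0"] u s(1) H_le d_eq by auto
      also have "\<beta> (r (s n)) (u - s n) \<le> \<beta> (r (s n)) 0"
        using class_KL_le_at_0[OF KL r_nonneg] u by simp
      finally show ?thesis using \<beta>n by (simp add: G gain_argument_def d_def algebra_simps)
    qed
    have drop: "(\<sigma> n - \<sigma> (Suc n)) * H t0 \<le> \<gamma> (\<sigma> n * G) * (s (Suc n) - s n)"
      using decay[OF s(1) s_le rG] s(3) by (simp add: algebra_simps)
    then have *: "\<gamma> (\<sigma> n * G) * \<tau> n \<le> \<gamma> (\<sigma> n * G) * (s (Suc n) - s n)"
      using speed[of n] by simp
    have "0 < (\<sigma> n - \<sigma> (Suc n)) * H t0" using \<sigma>_dec(1)[of n] pos by simp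
    then have "\<gamma> (\<sigma> n * G) \<noteq> 0"
      using drop by fastforce
    moreover have "0 \<le> \<sigma> n * G" using rG[of "s n"] r_nonneg[of "s n"] s_le[of n] by simp
    ultimately have "0 < \<gamma> (\<sigma> n * G)" using class_K_nonneg[OF K, of "\<sigma> n * G"] by simp
    then show ?case using * by simp
  qed
  obtain n where "T < s n" using unbounded_of_gaps[OF div, of 1 s T] gap by auto
  then show False using s(2)[of n] by simp
qed

text \<open>Starting from rest, \<open>- H\<close> is nonnegative and grows at a rate at most \<open>\<gamma> (c * (- H))\<close>, so the
  claim is an instance of Osgood's uniqueness criterion. The integral of \<open>1 / \<gamma> (c * \<eta>)\<close> diverges
  at \<open>0\<close>: its part between the levels \<open>\<epsilon> * \<sigma> (i + 1)\<close> and \<open>\<epsilon> * \<sigma> i\<close> is at least a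
  fixed multiple of \<open>\<tau> i\<close>. Followed backwards in time through these levels, \<open>H\<close> cannot reach \<open>0\<close> in finite time.\<close>

lemma H_nonneg_from_rest:
  assumes P1: "condition_P1 \<sigma>"
    and M: "0 < M"
    and speed: "\<And>b. 0 < b \<Longrightarrow> b \<le> M \<Longrightarrow> \<exists>k>0. \<forall>i. \<gamma> (\<sigma> i * b) * \<tau> i \<le> k * (\<sigma> i - \<sigma> (Suc i))"
    and div: "filterlim (\<lambda>n. \<Sum>i<n. \<tau> i) at_top sequentially"
    and r0: "r t0 = 0" and H0: "H t0 = 0" and T: "t0 \<le> T"
  shows "0 \<le> H T"
proof (rule ccontr)
  assume neg: "\<not> 0 \<le> H T"
  note \<sigma>_dec = condition_P1_decreasing[OF P1]
  have \<sigma>0: "\<sigma> 0 = 1" using P1 by (simp add: condition_P1_def)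
  have \<sigma>_le1: "\<sigma> i \<le> 1" for i
    using lift_Suc_antimono_le[of \<sigma> 0 i] \<sigma>0 \<sigma>_dec(1) by (simp add: less_imp_le)
  \<comment> \<open>\<open>H\<close> has passed the level \<open>- \<epsilon>\<close> by time \<open>T\<close>, and the bound \<open>\<epsilon> * c\<close> of \<open>r\<close> up to that passage lies in
    the range where the growth of \<open>\<gamma>\<close> is controlled.\<close>
  define \<epsilon> where "\<epsilon> = min (- H T) (M / c)"
  have \<epsilon>: "0 < \<epsilon>" "\<epsilon> \<le> - H T" "\<epsilon> * c \<le> M"
    using neg M c by (auto simp: \<epsilon>_def min_def field_simps)
  obtain k where k: "0 < k" "\<And>i. \<gamma> (\<sigma> i * (\<epsilon> * c)) * \<tau> i \<le> k * (\<sigma> i - \<sigma> (Suc i))"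
    using speed[of "\<epsilon> * c"] \<epsilon> c by auto
  have "\<exists>s\<ge>t0. s \<le> T \<and> H s = - (\<epsilon> * \<sigma> i)" for i
  proof (rule attains[OF T])
    have "\<epsilon> * \<sigma> i \<le> \<epsilon> * 1" by (intro mult_left_mono) (use \<epsilon>(1) \<sigma>_le1 in auto)
    then show "H T \<le> - (\<epsilon> * \<sigma> i)" using \<epsilon>(2) by simp
    show "- (\<epsilon> * \<sigma> i) \<le> H t0" using H0 \<epsilon>(1) \<sigma>_dec(2)[of i] by simp
  qed
  then obtain s where s: "\<And>i. t0 \<le> s i" "\<And>i. s i \<le> T" "\<And>i. H (s i) = - (\<epsilon> * \<sigma> i)"
    by metis
  have s_le: "s (Suc i) \<le> s i" for i
  proof (rule ccontr)
    assume "\<not> s (Suc i) \<le> s i"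
    then have "\<epsilon> * \<sigma> i \<le> \<epsilon> * \<sigma> (Suc i)" using antitone[of "s i" "s (Suc i)"] s by simp
    then show False using \<sigma>_dec(1)[of i] \<epsilon>(1) by simp
  qed
  have gap: "(\<epsilon> / k) * \<tau> i \<le> - s (Suc i) - (- s i)" for i
  proof -
    have rb: "r u \<le> \<sigma> i * (\<epsilon> * c)" if u: "u \<in> {s (Suc i)..s i}" for u
    proof -
      have u0: "t0 \<le> u" using s(1)[of "Suc i"] u by simp
      have "\<bar>H v\<bar> \<le> \<epsilon> * \<sigma> i" if "v \<in> {t0..u}" for v
        using antitone[of t0 v] antitone[of v "s i"] that u s(3)[of i] H0 by auto
      then have "r u \<le> \<beta> (r t0) (u - t0) + c * (\<epsilon> * \<sigma> i)" by (rule contraction[OF order_refl u0])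
      also have "\<beta> (r t0) (u - t0) \<le> 0" using class_KL_zero[OF KL] r0 u0 by simp
      finally show ?thesis by (simp add: algebra_simps)
    qed
    let ?g = "\<gamma> (\<sigma> i * (\<epsilon> * c))"
    have "0 < ?g" by (rule class_K_pos[OF K]) (simp add: \<epsilon>(1) c \<sigma>_dec(2))
    have "\<epsilon> * (?g * \<tau> i) \<le> \<epsilon> * (k * (\<sigma> i - \<sigma> (Suc i)))"
      using k(2) \<epsilon>(1) by (intro mult_left_mono) auto
    also have "\<dots> = k * (H (s (Suc i)) - H (s i))" by (simp add: s(3) algebra_simps)
    also have "\<dots> \<le> k * (?g * (s i - s (Suc i)))"
      using decay[OF s(1) s_le rb] k(1) by (intro mult_left_mono) auto
    finally have "?g * (\<epsilon> * \<tau> i) \<le> ?g * (k * (s i - s (Suc i)))" by (simp add: algebra_simps)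
    then have "\<epsilon> * \<tau> i \<le> k * (s i - s (Suc i))" using \<open>0 < ?g\<close> by simp
    then show ?thesis using k(1) by (simp add: field_simps)
  qed
  obtain n where "- t0 < - s n"
    using unbounded_of_gaps[OF div, of "\<epsilon> / k" "\<lambda>i. - s i" "- t0"] gap \<epsilon>(1) k(1) by auto
  then show False using s(1)[of n] by simp
qed

end

section \<open>Reduction of the interconnection to the scalar loop\<close>

lemma set_integral_le_const:
  fixes f :: "real \<Rightarrow> real"
  assumes "set_integrable lebesgue {s..t} f" "\<And>u. u \<in> {s..t} \<Longrightarrow> f u \<le> k" "s \<le> t"
  shows "(LINT u:{s..t}|lebesgue. f u) \<le> k * (t - s)"
proof -
  have "(LINT u:{s..t}|lebesgue. f u) \<le> (LINT u:{s..t}|lebesgue. k)"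
    by (rule set_integral_mono) (use assms in \<open>auto simp: set_integrable_def\<close>)
  also have "\<dots> = k * (t - s)"
    using \<open>s \<le> t\<close> by (simp add: set_lebesgue_integral_def)
  finally show ?thesis .
qed

lemma interconnection_feedback_loop:
  fixes A :: "(real^'n) set" and h :: "real^'m \<Rightarrow> real"
  assumes "input_state_system Uw Z Sw"
    and con: "contracting Ua Sa A \<beta> c" and wan: "wandering Uw Z Sw h \<gamma>0 \<gamma>1"
    and "0 \<le> t0" and sol: "interconnection_solution Ua Sa Uw Sw A h t0 x0 z0 x z"
  shows "feedback_loop t0 c (\<lambda>t. infdist (x t) A) (\<lambda>t. h (z t)) \<gamma>0 \<beta>"
proof -
  obtain ua uw where u: "ua \<in> Ua t0" "uw \<in> Uw t0"
    and eq: "\<And>t. t0 \<le> t \<Longrightarrow> x t = Sa t0 ua x0 t" "\<And>t. t0 \<le> t \<Longrightarrow> z t = Sw t0 uw z0 t"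
      "\<And>t. t0 \<le> t \<Longrightarrow> ua t = h (z t)" "\<And>t. t0 \<le> t \<Longrightarrow> uw t = infdist (x t) A"
    using sol unfolding interconnection_solution_def by blast
  have K0: "class_K \<gamma>0" and K1: "class_K \<gamma>1"
    using wan by (auto simp: wandering_def class_K_inf_def)
  have W: "set_integrable lebesgue {s..t} (\<lambda>\<tau>. \<gamma>0 (uw \<tau>))"
    "(LINT \<tau>:{s..t}|lebesgue. \<gamma>1 (uw \<tau>)) \<le> h (z s) - h (z t)"
    "h (z s) - h (z t) \<le> (LINT \<tau>:{s..t}|lebesgue. \<gamma>0 (uw \<tau>))"
    if "t0 \<le> s" "s \<le> t" for s t
    using wan u(2) that \<open>0 \<le> t0\<close> eq(2)[of s] eq(2)[of t] unfolding wandering_def by auto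
  show ?thesis
  proof
    show "class_KL \<beta>" "0 < c" using con by (auto simp: contracting_def)
    show "class_K \<gamma>0" by (rule K0)
    show "0 \<le> infdist (x t) A" for t by (rule infdist_nonneg)
    have "bounded (uw ` {t0..})"
      using assms(1) u(2) \<open>0 \<le> t0\<close> unfolding input_state_system_def L_inf_def by blast
    then obtain R where "\<And>t. t0 \<le> t \<Longrightarrow> \<bar>uw t\<bar> \<le> R" by (auto simp: bounded_iff)
    then show "\<exists>R. \<forall>t\<ge>t0. infdist (x t) A \<le> R" using eq(4) by (metis abs_ge_self order_trans)
  next
    fix s t k :: real
    assume st: "t0 \<le> s" "s \<le> t" and b: "\<And>u. u \<in> {s..t} \<Longrightarrow> \<bar>h (z u)\<bar> \<le> k"
    have "infdist (Sa t0 ua x0 t) A \<le> \<beta> (infdist (Sa t0 ua x0 s) A) (t - s) + c * sup_norm ua s t"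
      using con u(1) st \<open>0 \<le> t0\<close> unfolding contracting_def by blast
    moreover have "sup_norm ua s t \<le> k"
      unfolding sup_norm_def by (rule cSUP_least) (use st b eq(3) in auto)
    then have "c * sup_norm ua s t \<le> c * k"
      using con by (simp add: contracting_def)
    ultimately show "infdist (x t) A \<le> \<beta> (infdist (x s) A) (t - s) + c * k"
      using st eq(1)[of s] eq(1)[of t] by simp
  next
    fix s t :: real
    assume st: "t0 \<le> s" "s \<le> t"
    have "0 \<le> (LINT \<tau>:{s..t}|lebesgue. \<gamma>1 (uw \<tau>))"
      unfolding set_lebesgue_integral_def
      using st eq(4) class_K_nonneg[OF K1 infdist_nonneg]
      by (intro Bochner_Integration.integral_nonneg) (auto simp: indicator_def)
    then show "h (z t) \<le> h (z s)" using W(2)[OF st] by simp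
  next
    fix s t k :: real
    assume st: "t0 \<le> s" "s \<le> t" and b: "\<And>u. u \<in> {s..t} \<Longrightarrow> infdist (x u) A \<le> k"
    have "(LINT \<tau>:{s..t}|lebesgue. \<gamma>0 (uw \<tau>)) \<le> \<gamma>0 k * (t - s)"
      by (rule set_integral_le_const[OF W(1)[OF st] _ st(2)])
        (use st eq(4) b in \<open>auto intro!: class_K_mono[OF K0] infdist_nonneg\<close>)
    then show "h (z s) - h (z t) \<le> \<gamma>0 k * (t - s)" using W(3)[OF st] by simp
  qed
qed

text \<open>A point of the sublevel set is found on the segment from \<open>x\<close> to a nearest point of \<open>A\<close>.\<close>

lemma infdist_sublevel_infdist:
  fixes A :: "'a::euclidean_space set"
  assumes "compact A" "A \<noteq> {}" "0 \<le> l"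
  obtains p where "infdist p A \<le> l" "dist x p \<le> max 0 (infdist x A - l)"
proof (cases "infdist x A \<le> l")
  case True
  then show ?thesis using that[of x] by simp
next
  case False
  define d where "d = infdist x A"
  have d: "0 < d" "l < d" using False assms(3) by (auto simp: d_def)
  obtain q where q: "q \<in> A" "d = dist x q"
    using infdist_attains_inf[of A x] assms by (auto simp: d_def compact_imp_closed)
  define p where "p = q + (l / d) *\<^sub>R (x - q)"
  have "dist p q = l"
    using d assms(3) q(2) by (simp add: p_def dist_norm)
  then have "infdist p A \<le> l" using infdist_le[OF q(1), of p] by simp
  have "x - p = (1 - l / d) *\<^sub>R (x - q)" by (simp add: p_def algebra_simps)
  then have "dist x p = (1 - l / d) * d"
    using d q(2) by (simp add: dist_norm)
  also have "\<dots> = d - l" using d by (simp add: field_simps)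
  finally have "dist x p \<le> max 0 (infdist x A - l)" by (simp add: d_def)
  with \<open>infdist p A \<le> l\<close> show ?thesis by (rule that)
qed

lemma converges_into_Omega_a:
  fixes x :: "real \<Rightarrow> real^'n" and z :: "real \<Rightarrow> real^'m"
  assumes A: "compact A" "A \<noteq> {}" and "0 < c" and "0 \<le> h z0"
    and z: "\<And>t. t0 \<le> t \<Longrightarrow> h (z t) \<in> {0..h z0}"
    and x: "\<And>t. t0 \<le> t \<Longrightarrow> infdist (x t) A \<le> e t + c * h z0"
    and e: "(e \<longlongrightarrow> 0) at_top"
  shows "converges_into (\<lambda>t. (x t, z t)) (Omega_a A h c z0)"
proof -
  have l: "0 \<le> c * h z0" using assms by simp
  obtain q where "q \<in> A" using A by blast
  then have ne: "(q, z0) \<in> Omega_a A h c z0" using l assms by (simp add: Omega_a_def)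
  have le: "infdist (x t, z t) (Omega_a A h c z0) \<le> max 0 (e t)" if "t0 \<le> t" for t
  proof -
    obtain p where p: "infdist p A \<le> c * h z0" "dist (x t) p \<le> max 0 (infdist (x t) A - c * h z0)"
      by (rule infdist_sublevel_infdist[OF A l])
    have "(p, z t) \<in> Omega_a A h c z0" using p(1) z[OF that] by (simp add: Omega_a_def)
    then have "infdist (x t, z t) (Omega_a A h c z0) \<le> dist (x t, z t) (p, z t)" by (rule infdist_le)
    also have "\<dots> \<le> max 0 (e t)" using p(2) x[OF that] by (simp add: dist_Pair_Pair)
    finally show ?thesis .
  qed
  have "((\<lambda>t. max 0 (e t)) \<longlongrightarrow> max 0 0) at_top" by (intro tendsto_max tendsto_const e)
  then have lim: "((\<lambda>t. max 0 (e t)) \<longlongrightarrow> 0) at_top" by simp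
  have "((\<lambda>t. infdist (x t, z t) (Omega_a A h c z0)) \<longlongrightarrow> 0) at_top"
  proof (rule tendsto_sandwich[OF _ _ tendsto_const lim])
    show "\<forall>\<^sub>F t in at_top. 0 \<le> infdist (x t, z t) (Omega_a A h c z0)" by (simp add: infdist_nonneg)
    show "\<forall>\<^sub>F t in at_top. infdist (x t, z t) (Omega_a A h c z0) \<le> max 0 (e t)"
      using le by (rule eventually_at_top_linorderI)
  qed
  then show ?thesis using ne by (auto simp: converges_into_def)
qed

section \<open>Convergence of the interconnection\<close>

theorem theorem1:
  fixes Ua Uw :: "real \<Rightarrow> (real \<Rightarrow> real) set"
    and X :: "real \<Rightarrow> (real \<Rightarrow> real^'n) set" and Z :: "real \<Rightarrow> (real \<Rightarrow> real^'m) set"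
    and Sa :: "(real^'n) flow" and Sw :: "(real^'m) flow"
    and A :: "(real^'n) set" and h :: "real^'m \<Rightarrow> real"
    and \<beta> :: "real \<Rightarrow> real \<Rightarrow> real" and c :: real
    and \<gamma>0 \<gamma>1 \<gamma>01 \<gamma>02 :: "real \<Rightarrow> real" and M \<Delta>0 :: real
    and \<sigma> \<xi> \<tau> :: "nat \<Rightarrow> real"
    and \<rho>\<phi> \<rho>\<upsilon> :: "nat \<Rightarrow> nat \<Rightarrow> real \<Rightarrow> real"
    and B1 :: "real \<Rightarrow> real" and B2 :: "real \<Rightarrow> real \<Rightarrow> real"
  assumes "input_state_system Ua X Sa" and "forward_complete Ua X Sa"
    and "input_state_system Uw Z Sw"
    and "contracting Ua Sa A \<beta> c"
    and "wandering Uw Z Sw h \<gamma>0 \<gamma>1"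
    and "product_bound \<gamma>0 M \<gamma>01 \<gamma>02" and "\<And>i. \<sigma> i \<in> {0..M}"
    and "\<And>i. 0 \<le> \<xi> i" and "\<And>i. 0 < \<tau> i"
    and "condition_P1 \<sigma>"
    and "condition_P2 \<beta> \<xi> \<tau>"
    and "condition_P3 \<beta> c A h \<sigma> \<xi> \<rho>\<phi> \<rho>\<upsilon> B1 B2"
    and "0 < \<Delta>0" and "\<And>i. 1 / \<tau> i * ((\<sigma> i - \<sigma> (Suc i)) / \<gamma>01 (\<sigma> i)) \<ge> \<Delta>0"
    and "Omega_gamma A h c B1 B2 \<gamma>02 \<Delta>0 \<noteq> {}"
    and "filterlim (\<lambda>n. \<Sum>i<n. \<tau> i) at_top sequentially"
  shows "\<forall>(x0, z0) \<in> Omega_gamma A h c B1 B2 \<gamma>02 \<Delta>0.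
           gain_argument A h c B1 B2 x0 z0 \<in> {0..M} \<longrightarrow>
           (\<forall>t0\<ge>0. \<forall>x z. interconnection_solution Ua Sa Uw Sw A h t0 x0 z0 x z \<longrightarrow>
              converges_into (\<lambda>t. (x t, z t)) (Omega_a A h c z0))"
proof (intro ballI, clarify)
  fix x0 z0 t0 x z
  assume "(x0, z0) \<in> Omega_gamma A h c B1 B2 \<gamma>02 \<Delta>0"
    and GM: "gain_argument A h c B1 B2 x0 z0 \<in> {0..M}" and t0: "0 \<le> (t0::real)"
    and sol: "interconnection_solution Ua Sa Uw Sw A h t0 x0 z0 x z"
  define G where "G = gain_argument A h c B1 B2 x0 z0"
  have G: "\<gamma>02 G \<le> h z0 * \<Delta>0" "0 \<le> G" "G \<le> M"
    using \<open>(x0, z0) \<in> _\<close> GM by (auto simp: Omega_gamma_def G_def)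
  interpret feedback_loop t0 c "\<lambda>t. infdist (x t) A" "\<lambda>t. h (z t)" \<gamma>0 \<beta>
    by (rule interconnection_feedback_loop[OF assms(3,4,5) t0 sol])
  have init: "x t0 = x0" "z t0 = z0"
    using sol assms(1,3) t0 unfolding interconnection_solution_def input_state_system_def
    by (metis order_refl)+
  have A: "compact A" "A \<noteq> {}" using assms(4) by (auto simp: contracting_def)
  have nn: "0 \<le> \<gamma>01 a" "0 \<le> \<gamma>02 a" if "0 \<le> a" for a
    using assms(6) that by (auto simp: product_bound_def)
  have prod: "\<gamma>0 (a * b) \<le> \<gamma>01 a * \<gamma>02 b" if "a \<in> {0..M}" "b \<in> {0..M}" for a b
    using assms(6) that by (auto simp: product_bound_def)
  have h0: "0 \<le> h z0" using nn(2)[OF G(2)] G(1) assms(13) by (smt (verit) mult_neg_pos)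
  note \<sigma>_dec = condition_P1_decreasing[OF assms(10)]
  have \<sigma>0: "\<sigma> 0 = 1" using assms(10) by (simp add: condition_P1_def)
  have rate: "\<gamma>01 (\<sigma> i) * (\<Delta>0 * \<tau> i) \<le> \<sigma> i - \<sigma> (Suc i)" for i
  proof -
    \<comment> \<open>Otherwise the quotient in the rate condition, being a division by zero, would be \<open>0 < \<Delta>0\<close>.\<close>
    have "\<gamma>01 (\<sigma> i) \<noteq> 0" using assms(13) assms(14)[of i] by auto
    then have "0 < \<gamma>01 (\<sigma> i)" using nn(1)[of "\<sigma> i"] \<sigma>_dec(2)[of i] by simp
    then show ?thesis using assms(14)[of i] assms(9)[of i] by (simp add: field_simps)
  qed
  have speed: "\<gamma>0 (\<sigma> i * b) * \<tau> i \<le> l * (\<sigma> i - \<sigma> (Suc i))"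
    if b: "b \<in> {0..M}" "\<gamma>02 b \<le> l * \<Delta>0" "0 \<le> l" for b l i
  proof -
    have "\<gamma>0 (\<sigma> i * b) * \<tau> i \<le> (\<gamma>01 (\<sigma> i) * \<gamma>02 b) * \<tau> i"
      using prod[OF assms(7) b(1)] assms(9)[of i] by (intro mult_right_mono) auto
    also have "\<dots> \<le> (\<gamma>01 (\<sigma> i) * (l * \<Delta>0)) * \<tau> i"
      using b(2) nn(1)[of "\<sigma> i"] \<sigma>_dec(2)[of i] assms(9)[of i]
      by (intro mult_right_mono mult_left_mono) auto
    also have "\<dots> = l * (\<gamma>01 (\<sigma> i) * (\<Delta>0 * \<tau> i))" by (simp add: mult_ac)
    also have "\<dots> \<le> l * (\<sigma> i - \<sigma> (Suc i))" using rate b(3) by (rule mult_left_mono)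
    finally show ?thesis .
  qed
  have nonneg: "0 \<le> h (z T)" if T: "t0 \<le> T" for T
  proof (cases "h z0 = 0")
    case False
    have "\<gamma>0 (\<sigma> i * G) * \<tau> i \<le> (\<sigma> i - \<sigma> (Suc i)) * h z0" for i
      using speed[of G "h z0" i] G h0 by (simp add: mult.commute)
    then have "0 < h (z T)"
      using H_pos_forever[OF assms(8,10,11,12) _ _ G_def _ assms(16) _ T] init False h0 by simp
    then show ?thesis by simp
  next
    case True
    have M1: "1 \<in> {0..M}" using assms(7)[of 0] \<sigma>0 by simp
    \<comment> \<open>Here \<open>\<gamma>02 G\<close> vanishes, so \<open>G\<close> does; the terms \<open>n = 0\<close> of the bounds in (P3) give \<open>x0 \<in> A\<close>.\<close>
    have "\<gamma>0 (1 * G) \<le> \<gamma>01 1 * \<gamma>02 G" using prod[OF M1] G by simp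
    also have "\<dots> \<le> 0" using G(1) True nn(1)[of 1] by (simp add: mult_nonneg_nonpos)
    finally have "G = 0" using class_K_pos[OF K, of G] G(2) by fastforce
    moreover have "\<beta> (infdist x0 A) 0 \<le> B1 (infdist x0 A)"
    proof -
      have "inverse (\<sigma> 0) * phi \<beta> \<xi> \<rho>\<phi> 0 0 (infdist x0 A) \<le> B1 (infdist x0 A)"
        using assms(12) unfolding condition_P3_def by blast
      then show ?thesis using \<sigma>0 by simp
    qed
    moreover have "0 \<le> B2 \<bar>h z0\<bar> c"
    proof -
      have "inverse (\<sigma> 0) * (\<Sum>i=0..0. upsilon \<beta> \<xi> \<rho>\<phi> \<rho>\<upsilon> 0 i (c * \<bar>h z0\<bar> * \<sigma> (0 - i))) \<le> B2 \<bar>h z0\<bar> c"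
        using assms(12) unfolding condition_P3_def by blast
      moreover have "0 \<le> \<beta> 0 0" using class_K_nonneg[OF class_KL_at_0[OF KL], of 0] by simp
      ultimately show ?thesis using \<sigma>0 True by (simp add: upsilon_def)
    qed
    ultimately have "\<beta> (infdist x0 A) 0 \<le> 0"
      using True by (simp add: G_def gain_argument_def)
    then have r0: "infdist x0 A = 0"
      using class_K_pos[OF class_KL_at_0[OF KL], of "infdist x0 A"] infdist_nonneg[of x0 A] by fastforce
    have "\<exists>k>0. \<forall>i. \<gamma>0 (\<sigma> i * b) * \<tau> i \<le> k * (\<sigma> i - \<sigma> (Suc i))" if "0 < b" "b \<le> M" for b
    proof -
      have "0 < \<gamma>01 1 * \<gamma>02 b" using prod[OF M1, of b] class_K_pos[OF K that(1)] that by simp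
      then have "0 < \<gamma>02 b" using nn(1)[of 1] by (simp add: zero_less_mult_iff)
      then show ?thesis
        using speed[of b "\<gamma>02 b / \<Delta>0"] that assms(13) by (intro exI[of _ "\<gamma>02 b / \<Delta>0"]) simp
    qed
    then show ?thesis
      using H_nonneg_from_rest[OF assms(10) _ _ assms(16) _ _ T, of M] init r0 True M1 by simp
  qed
  have in_range: "h (z t) \<in> {0..h z0}" if "t0 \<le> t" for t
    using nonneg[OF that] antitone[OF order_refl that] init by simp
  have estimate: "infdist (x t) A \<le> \<beta> (infdist x0 A) (t - t0) + c * h z0" if "t0 \<le> t" for t
    using contraction[OF order_refl that, of "h z0"] in_range init by auto
  have "(\<beta> (infdist x0 A) \<longlongrightarrow> 0) at_top"
    using KL infdist_nonneg[of x0 A] unfolding class_KL_def by blast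
  moreover have "filterlim (\<lambda>t. t - t0) at_top at_top"
    using filterlim_tendsto_add_at_top[OF tendsto_const[of "- t0"] filterlim_ident] by simp
  ultimately have vanish: "((\<lambda>t. \<beta> (infdist x0 A) (t - t0)) \<longlongrightarrow> 0) at_top"
    by (rule filterlim_compose)
  show "converges_into (\<lambda>t. (x t, z t)) (Omega_a A h c z0)"
    by (rule converges_into_Omega_a[OF A c h0 in_range estimate vanish])
qed

end
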